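(* Let $R$ be a Noetherian ring. For a filtration $\mathcal{I} = \{I_m\}_{m\in\mathbb{N}}$ of ideals in $R$, define $$K(\mathcal{I})_m := \{f\in R \mid \overline{\nu}_{\mathcal{I}}(f) \ge m\}\quad \text{for all } m\in\mathbb{N}.$$ Then $\mathcal{K}(\mathcal{I}) := \{K(\mathcal{I})_m\}_{m\in\mathbb{N}}$ is a filtration of ideals in $R$ and $\mathcal{I} \subseteq \mathcal{K}(\mathcal{I})$. Moreover, $\overline{\nu}_{\mathcal{I}} = \overline{\nu}_{\mathcal{K}(\mathcal{I})}$, and $\mathcal{K}(\mathcal{I})$ is the unique largest filtration $\mathcal{J}$ of $R$ such that $\overline{\nu}_{\mathcal{I}} = \overline{\nu}_{\mathcal{J}}$ (that is, every filtration $\mathcal{J}$ of $R$ with $\overline{\nu}_{\mathcal{J}} = \overline{\nu}_{\mathcal{I}}$ satisfies $\mathcal{J}\subseteq\mathcal{K}(\mathcal{I})$).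
   Context: Rings are commutative with identity, and $\mathbb{N}$ denotes the nonnegative integers. A filtration of a ring $R$ is a family $\mathcal{I} = \{I_m\}_{m\in\mathbb{N}}$ of ideals of $R$ with $I_0 = R$, $I_n \supseteq I_{n+1}$ and $I_n I_m \subseteq I_{n+m}$ for all $m,n \in \mathbb{N}$. For filtrations $\mathcal{I}=\{I_m\}$ and $\mathcal{J}=\{J_m\}$, write $\mathcal{I}\subseteq\mathcal{J}$ if $I_m\subseteq J_m$ for all $m\in\mathbb{N}$. The order of $\mathcal{I}$ is $\nu_{\mathcal{I}}(f) = \sup\{m \mid f \in I_m\} \in \mathbb{N}\cup\{\infty\}$ for $f \in R$. The asymptotic Samuel function of $\mathcal{I}$ is $\overline{\nu}_{\mathcal{I}} : R \to \mathbb{R}_{\ge 0}\cup\{\infty\}$, $\overline{\nu}_{\mathcal{I}}(x) = \lim_{n\to\infty} \nu_{\mathcal{I}}(x^n)/n$ (this limit always exists in $\mathbb{R}_{\ge 0}\cup\{\infty\}$). *)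

theory Defs
  imports
    "HOL-Library.Extended_Nonnegative_Real"
    "HOL-Algebra.Ring_Divisibility"
    "HOL-Algebra.Ideal_Product"
begin

locale ring_filtration = cring R for R (structure) +
  fixes I :: "nat \<Rightarrow> 'a set"
  assumes ideal: "ideal (I m) R"
    and zero: "I 0 = carrier R"
    and decreasing: "I (Suc n) \<subseteq> I n"
    and mult: "I n \<cdot> I m \<subseteq> I (n + m)"

definition filt_order :: "(nat \<Rightarrow> 'a set) \<Rightarrow> 'a \<Rightarrow> enat" where
  "filt_order I f = Sup {enat m | m. f \<in> I m}"

text \<open>The quotient at \<open>n = 0\<close> is irrelevant for the limit. Convergence is proved below
  (\<open>asymptotic_samuel_tendsto\<close>), so \<^const>\<open>lim\<close> never takes an unspecified value here.\<close>

definition asymptotic_samuel ::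
    "('a, 'b) ring_scheme \<Rightarrow> (nat \<Rightarrow> 'a set) \<Rightarrow> 'a \<Rightarrow> ennreal" where
  "asymptotic_samuel R I x =
     lim (\<lambda>n. ennreal_of_enat (filt_order I (x [^]\<^bsub>R\<^esub> n)) / of_nat n)"

definition K_filt :: "('a, 'b) ring_scheme \<Rightarrow> (nat \<Rightarrow> 'a set) \<Rightarrow> nat \<Rightarrow> 'a set" where
  "K_filt R I m = {f \<in> carrier R. of_nat m \<le> asymptotic_samuel R I f}"

lemma ennreal_superadditive_tendsto:
  fixes b :: "nat \<Rightarrow> ennreal"
  assumes super: "\<And>m n. b m + b n \<le> b (m + n)"
  shows "(\<lambda>n. b n / of_nat n) \<longlonglongrightarrow> (SUP n\<in>{1..}. b n / of_nat n)"
proof (rule order_tendstoI)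
  fix c assume c: "(SUP n\<in>{1..}. b n / of_nat n) < c"
  show "\<forall>\<^sub>F n in sequentially. b n / of_nat n < c"
    using eventually_ge_at_top[of "1::nat"]
  proof eventually_elim
    case (elim n)
    have "b n / of_nat n \<le> (SUP n\<in>{1..}. b n / of_nat n)"
      using elim by (intro SUP_upper) auto
    then show ?case using c by (rule le_less_trans)
  qed
next
  fix c assume "c < (SUP n\<in>{1..}. b n / of_nat n)"
  then obtain k where k: "k \<ge> 1" "c < b k / of_nat k"
    by (auto simp: less_SUP_iff)
  obtain c' where c': "c < c'" "c' < b k / of_nat k"
    using k(2) dense by blast
  define e where "e = enn2real c'"
  have "c' < \<infinity>" using c'(2) by (auto intro: less_le_trans)
  then have e: "c' = ennreal e" "e \<ge> 0" unfolding e_def by auto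
  define d where "d = e * real k"
  have d: "d \<ge> 0" "ennreal d \<le> b k"
  proof -
    show "d \<ge> 0" using e by (simp add: d_def)
    have "ennreal e * of_nat k \<le> b k / of_nat k * of_nat k"
      using c'(2) unfolding e by (intro mult_right_mono) auto
    also have "\<dots> = b k"
    proof -
      have "of_nat k / of_nat k = (1 :: ennreal)"
        using k(1) by (intro ennreal_divide_self) (auto intro: of_nat_less_top)
      then show ?thesis by (simp add: ennreal_divide_times)
    qed
    finally show "ennreal d \<le> b k"
      using e(2) by (simp add: d_def ennreal_mult ennreal_of_nat_eq_real_of_nat)
  qed
  have mono: "b m \<le> b (m + n)" for m n
    using super[of m n] by (meson order_trans add_increasing2 order_refl zero_le)
  have mul: "of_nat q * b k \<le> b (q * k)" for q
  proof (induction q)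
    case (Suc q)
    have "of_nat (Suc q) * b k = b k + of_nat q * b k" by (simp add: distrib_right)
    also have "\<dots> \<le> b k + b (q * k)" using Suc by (intro add_left_mono)
    also have "\<dots> \<le> b (Suc q * k)" using super[of k "q * k"] by simp
    finally show ?case .
  qed auto
  have "(\<lambda>n. e - d * inverse (real n)) \<longlonglongrightarrow> e - d * 0"
    by (intro tendsto_intros lim_inverse_n)
  then have "(\<lambda>n. ennreal (e - d * inverse (real n))) \<longlonglongrightarrow> ennreal e"
    by (auto intro: tendsto_ennrealI)
  then have "\<forall>\<^sub>F n in sequentially. c < ennreal (e - d * inverse (real n))"
    using c'(1) e(1) order_tendstoD(1) by blast
  then show "\<forall>\<^sub>F n in sequentially. c < b n / of_nat n"
    using eventually_ge_at_top[of "1::nat"]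
  proof eventually_elim
    case (elim n)
    define q where "q = n div k"
    have "n = q * k + n mod k" by (simp add: q_def)
    then have "real n = real q * real k + real (n mod k)" by (metis of_nat_add of_nat_mult)
    moreover have "real (n mod k) \<le> real k" using k(1) by (simp add: less_imp_le)
    ultimately have "real n \<le> real q * real k + real k" by linarith
    then have "e * real n \<le> e * (real q * real k + real k)" using e(2) by (intro mult_left_mono)
    then have "e * real n / real n \<le> e * (real q * real k + real k) / real n"
      by (rule divide_right_mono) simp
    also have "\<dots> = real q * d / real n + d * inverse (real n)"
      by (simp add: d_def divide_inverse algebra_simps)
    finally have "e - d * inverse (real n) \<le> real q * d / real n"
      using elim(2) by simp
    then have "ennreal (e - d * inverse (real n)) \<le> ennreal (real q * d / real n)"
      by (rule ennreal_leI)
    also have "\<dots> = of_nat q * ennreal d / of_nat n"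
      using elim(2) d(1)
      by (simp add: divide_ennreal[symmetric] ennreal_mult ennreal_of_nat_eq_real_of_nat)
    also have "\<dots> \<le> of_nat q * b k / of_nat n"
      using d(2) by (intro divide_right_mono_ennreal mult_left_mono) auto
    also have "\<dots> \<le> b (q * k) / of_nat n"
      using mul by (intro divide_right_mono_ennreal)
    also have "\<dots> \<le> b n / of_nat n"
      using mono[of "q * k" "n mod k"] \<open>n = _\<close> by (intro divide_right_mono_ennreal) simp
    finally show ?case using elim(1) by (rule less_le_trans[rotated])
  qed
qed

context ring_filtration
begin

lemma antimono: "m \<le> n \<Longrightarrow> I n \<subseteq> I m"
  using lift_Suc_antimono_le[of I, OF decreasing] .

lemma le_filt_order_iff:
  assumes "f \<in> carrier R"
  shows "enat m \<le> filt_order I f \<longleftrightarrow> f \<in> I m"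
proof
  assume m: "enat m \<le> filt_order I f"
  show "f \<in> I m"
  proof (cases m)
    case 0 then show ?thesis using zero assms by simp
  next
    case (Suc j)
    then have "enat j < filt_order I f" using m by (metis Suc_ile_eq)
    then obtain i where i: "f \<in> I i" "j < i"
      unfolding filt_order_def less_Sup_iff by auto
    then show ?thesis using antimono[of m i] Suc by auto
  qed
qed (auto simp: filt_order_def intro!: Sup_upper)

lemma filt_order_mult:
  assumes "x \<in> carrier R" "y \<in> carrier R"
  shows "filt_order I x + filt_order I y \<le> filt_order I (x \<otimes> y)"
proof -
  have *: "enat p + enat q \<le> filt_order I (x \<otimes> y)"
    if "enat p \<le> filt_order I x" "enat q \<le> filt_order I y" for p q
  proof -
    have "x \<in> I p" "y \<in> I q" using that assms by (auto simp: le_filt_order_iff)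
    then have "x \<otimes> y \<in> I (p + q)" using mult[of p q] ideal_prod.prod by fastforce
    then show ?thesis using assms by (simp add: le_filt_order_iff)
  qed
  show ?thesis
  proof (cases "filt_order I x + filt_order I y")
    case (enat s)
    then obtain p q where "filt_order I x = enat p" "filt_order I y = enat q"
      by (cases "filt_order I x"; cases "filt_order I y") auto
    then show ?thesis using *[of p q] by simp
  next
    case infinity
    have "enat s \<le> filt_order I (x \<otimes> y)" for s
    proof -
      consider "filt_order I x = \<infinity>" | "filt_order I y = \<infinity>"
        using infinity by (auto simp: plus_eq_infty_iff_enat)
      then show ?thesis
        using *[of s 0] *[of 0 s] by cases (auto simp: zero_enat_def[symmetric])
    qed
    then have "filt_order I (x \<otimes> y) = \<infinity>"
      by (metis enat_ord_simps(1) not_infinity_eq not_less_eq_eq order_refl)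
    then show ?thesis by simp
  qed
qed

lemma asymptotic_samuel_tendsto:
  assumes "x \<in> carrier R"
  shows "(\<lambda>n. ennreal_of_enat (filt_order I (x [^] n)) / of_nat n)
           \<longlonglongrightarrow> asymptotic_samuel R I x"
proof -
  have "ennreal_of_enat (filt_order I (x [^] m)) + ennreal_of_enat (filt_order I (x [^] n))
      \<le> ennreal_of_enat (filt_order I (x [^] (m + n)))" for m n :: nat
  proof -
    have "filt_order I (x [^] m) + filt_order I (x [^] n) \<le> filt_order I (x [^] (m + n))"
      using filt_order_mult[of "x [^] m" "x [^] n"] assms by (simp add: nat_pow_mult)
    then show ?thesis
      by (simp only: ennreal_of_enat_plus[symmetric] ennreal_of_enat_le_iff)
  qed
  from ennreal_superadditive_tendsto[OF this] show ?thesis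
    unfolding asymptotic_samuel_def by (metis limI)
qed

end

end

theory Submission
  imports Defs
begin

text \<open>
  The order of \<open>x\<^sup>n\<close> is bounded below by \<open>a n - C\<close>, with \<open>C\<close> independent of \<open>n\<close>, whenever
  \<open>a\<close> is smaller than the asymptotic Samuel function at \<open>x\<close>; conversely such a bound forces the
  function to be at least \<open>a\<close>. Bounds of this kind for \<open>x\<close> and \<open>y\<close> add up in every monomial of
  the expansion of \<open>(x + y)\<^sup>n\<close>, which makes the level sets \<open>K\<close> ideals. The equality of the two
  asymptotic functions comes from homogeneity: the order of \<open>x\<^sup>n\<close> with respect to \<open>K\<close> is at
  most the asymptotic value of \<open>x\<^sup>n\<close>, which is \<open>n\<close> times that of \<open>x\<close>.
\<close>

text \<open>Induction on \<open>n\<close> with \<open>u\<close> arbitrary: one factor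
  \<open>x \<oplus> y\<close> is split off, and its two summands are absorbed into \<open>u\<close>.
  The monomials are thus reached one factor at a time, and no binomial coefficients occur. The
  locale \<open>ideal\<close> does not make the ring commutative, so this is assumed through
  \<open>comm_monoid R\<close>.\<close>

lemma (in ideal) add_pow_mem:
  assumes "x \<in> carrier R" "y \<in> carrier R" "u \<in> carrier R" "comm_monoid R"
    and "\<And>i j. i + j = n \<Longrightarrow> u \<otimes> (x [^] i \<otimes> y [^] j) \<in> I"
  shows "u \<otimes> (x \<oplus> y) [^] (n :: nat) \<in> I"
  using assms(3,5)
proof (induction n arbitrary: u)
  case 0
  then show ?case using 0(2)[of 0 0] by simp
next
  case (Suc n)
  interpret cm: comm_monoid R by fact
  have 1: "(u \<otimes> x) \<otimes> (x \<oplus> y) [^] n \<in> I"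
  proof (rule Suc.IH)
    fix i j assume "i + j = n"
    then show "(u \<otimes> x) \<otimes> (x [^] i \<otimes> y [^] j) \<in> I"
      using Suc.prems(2)[of "Suc i" j] Suc.prems(1) assms(1,2) by (simp add: cm.m_ac)
  qed (use Suc.prems assms in auto)
  have 2: "(u \<otimes> y) \<otimes> (x \<oplus> y) [^] n \<in> I"
  proof (rule Suc.IH)
    fix i j assume "i + j = n"
    then show "(u \<otimes> y) \<otimes> (x [^] i \<otimes> y [^] j) \<in> I"
      using Suc.prems(2)[of i "Suc j"] Suc.prems(1) assms(1,2) by (simp add: cm.m_ac)
  qed (use Suc.prems assms in auto)
  have "u \<otimes> (x \<oplus> y) [^] Suc n = (u \<otimes> x) \<otimes> (x \<oplus> y) [^] n \<oplus> (u \<otimes> y) \<otimes> (x \<oplus> y) [^] n"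
    using Suc.prems(1) assms(1,2) by (simp add: cm.m_ac l_distr r_distr)
  then show ?case using 1 2 by simp
qed

section \<open>Linear lower bounds for the order of powers\<close>

context ring_filtration
begin

lemma pow_mem_if_less_asymptotic_samuel:
  assumes x: "x \<in> carrier R" and a: "a \<ge> 0" "ennreal a < asymptotic_samuel R I x"
  obtains C where "\<And>n m. real m \<le> a * real n - C \<Longrightarrow> x [^] n \<in> I m"
proof -
  have "\<forall>\<^sub>F n in sequentially. ennreal a < ennreal_of_enat (filt_order I (x [^] n)) / of_nat n"
    using order_tendstoD(1)[OF asymptotic_samuel_tendsto[OF x] a(2)] .
  then obtain N where N:
    "\<And>n. n \<ge> N \<Longrightarrow> ennreal a < ennreal_of_enat (filt_order I (x [^] n)) / of_nat n"
    by (auto simp: eventually_sequentially)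
  show thesis
  proof (rule that[of "a * real N"])
    fix n m assume m: "real m \<le> a * real n - a * real N"
    show "x [^] n \<in> I m"
    proof (cases "m = 0")
      case True
      then show ?thesis using zero x by simp
    next
      case False
      then have "a * real N < a * real n" using m by simp
      then have "N < n" using a(1) by (simp add: mult_less_cancel_left)
      then have n: "N \<le> n" "n > 0" by simp_all
      have "real m \<le> a * real n" using m a(1) by (smt (verit) mult_nonneg_nonneg of_nat_0_le_iff)
      then have "ennreal (real m) \<le> ennreal (a * real n)" by (rule ennreal_leI)
      also have "\<dots> = ennreal a * of_nat n"
        using a(1) by (simp add: ennreal_mult ennreal_of_nat_eq_real_of_nat)
      also have "\<dots> \<le> ennreal_of_enat (filt_order I (x [^] n)) / of_nat n * of_nat n"
        using N[OF n(1)] by (intro mult_right_mono) auto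
      also have "\<dots> = ennreal_of_enat (filt_order I (x [^] n))"
        using n(2) by (simp add: ennreal_divide_times ennreal_divide_self of_nat_less_top)
      finally have "ennreal_of_enat (enat m) \<le> ennreal_of_enat (filt_order I (x [^] n))"
        by (simp add: ennreal_of_nat_eq_real_of_nat)
      then show ?thesis using x
        by (simp only: ennreal_of_enat_le_iff le_filt_order_iff nat_pow_closed)
    qed
  qed
qed

text \<open>The loss of \<open>C\<close>, plus at most 1 for rounding down to an integer level,
  vanishes after division by \<open>n\<close>: the quotients are at least
  \<open>a - (C + 1) / n\<close>, which tends to \<open>a\<close>.\<close>

lemma le_asymptotic_samuelI:
  assumes x: "x \<in> carrier R"
    and C: "\<And>n m. real m \<le> a * real n - C \<Longrightarrow> x [^] n \<in> I m"
  shows "ennreal a \<le> asymptotic_samuel R I x"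
proof (rule LIMSEQ_le[OF _ asymptotic_samuel_tendsto[OF x]])
  have "(\<lambda>n. a - (C + 1) * inverse (real n)) \<longlonglongrightarrow> a - (C + 1) * 0"
    by (intro tendsto_intros lim_inverse_n)
  then show "(\<lambda>n. ennreal (a - (C + 1) * inverse (real n))) \<longlonglongrightarrow> ennreal a"
    by (auto intro: tendsto_ennrealI)
  have "ennreal (a - (C + 1) * inverse (real n))
      \<le> ennreal_of_enat (filt_order I (x [^] n)) / of_nat n" if n: "n \<ge> 1" for n
  proof (cases "a * real n - C \<ge> 0")
    case True
    define m where "m = nat \<lfloor>a * real n - C\<rfloor>"
    have m: "real m \<le> a * real n - C" "a * real n - C \<le> real m + 1"
      using True unfolding m_def by linarith+
    then have "enat m \<le> filt_order I (x [^] n)" using C x by (simp add: le_filt_order_iff)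
    then have le: "of_nat m \<le> ennreal_of_enat (filt_order I (x [^] n))"
      by (metis ennreal_of_enat_enat ennreal_of_enat_le_iff)
    have "a - (C + 1) * inverse (real n) = (a * real n - C - 1) / real n"
      using n by (simp add: field_simps)
    also have "\<dots> \<le> real m / real n" using m(2) by (intro divide_right_mono) auto
    finally have "ennreal (a - (C + 1) * inverse (real n)) \<le> ennreal (real m / real n)"
      by (rule ennreal_leI)
    also have "\<dots> = of_nat m / of_nat n"
      using n by (simp add: divide_ennreal[symmetric] ennreal_of_nat_eq_real_of_nat)
    also have "\<dots> \<le> ennreal_of_enat (filt_order I (x [^] n)) / of_nat n"
      using le by (rule divide_right_mono_ennreal)
    finally show ?thesis .
  next
    \<comment> \<open>The real lower bound is negative here, and \<open>ennreal\<close> sends it to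
      0.\<close>
    case False
    have "a - (C + 1) * inverse (real n) = (a * real n - C - 1) / real n"
      using n by (simp add: field_simps)
    also have "\<dots> \<le> 0" using False by (intro divide_nonpos_nonneg) auto
    finally show ?thesis by (simp add: ennreal_neg)
  qed
  then show "\<exists>N. \<forall>n\<ge>N. ennreal (a - (C + 1) * inverse (real n))
      \<le> ennreal_of_enat (filt_order I (x [^] n)) / of_nat n"
    by blast
qed

section \<open>The asymptotic function on sums, products and powers\<close>

lemma asymptotic_samuel_add:
  assumes x: "x \<in> carrier R" and y: "y \<in> carrier R"
  shows "min (asymptotic_samuel R I x) (asymptotic_samuel R I y) \<le> asymptotic_samuel R I (x \<oplus> y)"
\<comment> \<open>Approaching the minimum from below gives the strict inequalities from which the
  linear bounds for \<open>x\<close> and \<open>y\<close> are drawn.\<close>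
proof (rule dense_le)
  fix c assume c: "c < min (asymptotic_samuel R I x) (asymptotic_samuel R I y)"
  then have "c < \<infinity>" by (auto intro: less_le_trans)
  then obtain a where a: "a \<ge> 0" "c = ennreal a" by (cases c) auto
  obtain C where C: "\<And>n m. real m \<le> a * real n - C \<Longrightarrow> x [^] n \<in> I m"
    using pow_mem_if_less_asymptotic_samuel[OF x a(1)] c a(2) by auto
  obtain D where D: "\<And>n m. real m \<le> a * real n - D \<Longrightarrow> y [^] n \<in> I m"
    using pow_mem_if_less_asymptotic_samuel[OF y a(1)] c a(2) by auto
  have "ennreal a \<le> asymptotic_samuel R I (x \<oplus> y)"
  proof (rule le_asymptotic_samuelI)
    show "x \<oplus> y \<in> carrier R" using x y by simp
  next
    \<comment> \<open>The constant pays for \<open>C\<close>, for \<open>D\<close>, and for one unit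
      of rounding in each of the exponents \<open>p\<close> and \<open>q\<close> below. If
      \<open>a * i - C\<close> is negative, then \<open>p = 0\<close>, and membership in
      \<open>I 0\<close> is trivial; likewise for \<open>q\<close>.\<close>
    fix n m assume m: "real m \<le> a * real n - (\<bar>C\<bar> + \<bar>D\<bar> + 2)"
    interpret Im: ideal "I m" R by (rule ideal)
    have "\<one> \<otimes> (x \<oplus> y) [^] n \<in> I m"
    proof (rule Im.add_pow_mem[OF x y])
      fix i j assume ij: "i + j = n"
      define p where "p = nat \<lfloor>a * real i - C\<rfloor>"
      define q where "q = nat \<lfloor>a * real j - D\<rfloor>"
      have nn: "0 \<le> a * real i" "0 \<le> a * real j" using a(1) by auto
      have xi: "x [^] i \<in> I p"
      proof (cases "a * real i - C \<ge> 0")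
        case True
        then show ?thesis by (intro C) (simp add: p_def)
      next
        case False
        then show ?thesis using zero x by (simp add: p_def)
      qed
      have yj: "y [^] j \<in> I q"
      proof (cases "a * real j - D \<ge> 0")
        case True
        then show ?thesis by (intro D) (simp add: q_def)
      next
        case False
        then show ?thesis using zero y by (simp add: q_def)
      qed
      have "real n = real i + real j" using ij by auto
      then have "a * real n = a * real i + a * real j" by (simp add: distrib_left)
      moreover have "a * real i - C \<le> real p + 1" "a * real j - D \<le> real q + 1"
        unfolding p_def q_def by linarith+
      ultimately have "real m \<le> real p + real q" using m by linarith
      then have "m \<le> p + q" by linarith
      moreover have "x [^] i \<otimes> y [^] j \<in> I (p + q)"
        using mult[of p q] ideal_prod.prod[OF xi yj] by blast
      ultimately have "x [^] i \<otimes> y [^] j \<in> I m" using antimono by blast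
      then show "\<one> \<otimes> (x [^] i \<otimes> y [^] j) \<in> I m" using x y by simp
    qed (auto intro: comm_monoid_axioms)
    then show "(x \<oplus> y) [^] n \<in> I m" using x y by simp
  qed
  then show "c \<le> asymptotic_samuel R I (x \<oplus> y)" by (simp add: a(2))
qed

text \<open>By commutativity \<open>(x \<otimes> y) [^] n\<close> is the product of the powers, so
  superadditivity of the order holds for each quotient and passes to the limit.\<close>

lemma asymptotic_samuel_mult:
  assumes x: "x \<in> carrier R" and y: "y \<in> carrier R"
  shows "asymptotic_samuel R I x + asymptotic_samuel R I y \<le> asymptotic_samuel R I (x \<otimes> y)"
proof (rule LIMSEQ_le)
  show "(\<lambda>n. ennreal_of_enat (filt_order I (x [^] n)) / of_nat n
      + ennreal_of_enat (filt_order I (y [^] n)) / of_nat n)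
      \<longlonglongrightarrow> asymptotic_samuel R I x + asymptotic_samuel R I y"
    using x y by (intro tendsto_add asymptotic_samuel_tendsto)
  show "(\<lambda>n. ennreal_of_enat (filt_order I ((x \<otimes> y) [^] n)) / of_nat n)
      \<longlonglongrightarrow> asymptotic_samuel R I (x \<otimes> y)"
    using x y by (intro asymptotic_samuel_tendsto) simp
  have "ennreal_of_enat (filt_order I (x [^] n)) / of_nat n
      + ennreal_of_enat (filt_order I (y [^] n)) / of_nat n
      \<le> ennreal_of_enat (filt_order I ((x \<otimes> y) [^] n)) / of_nat n" for n :: nat
    using filt_order_mult[of "x [^] n" "y [^] n"] x y
    by (simp add: nat_pow_distrib divide_right_mono_ennreal ennreal_of_enat_le_iff
        flip: add_divide_distrib_ennreal ennreal_of_enat_plus)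
  then show "\<exists>N. \<forall>n\<ge>N. ennreal_of_enat (filt_order I (x [^] n)) / of_nat n
      + ennreal_of_enat (filt_order I (y [^] n)) / of_nat n
      \<le> ennreal_of_enat (filt_order I ((x \<otimes> y) [^] n)) / of_nat n"
    by blast
qed

text \<open>Both sides are limits of the same sequence, the quotients for \<open>x\<close> along the
  multiples \<open>k * n\<close>: once as a subsequence, once as the quotients for
  \<open>x [^] k\<close> divided by \<open>k\<close>.\<close>

lemma asymptotic_samuel_pow:
  assumes x: "x \<in> carrier R" and k: "k \<ge> 1"
  shows "asymptotic_samuel R I (x [^] k) / of_nat k = asymptotic_samuel R I x"
proof (rule LIMSEQ_unique)
  let ?t = "\<lambda>n. ennreal_of_enat (filt_order I (x [^] n)) / of_nat n"
  have "strict_mono (\<lambda>n. k * n)" using k by (intro strict_monoI) simp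
  then have "(?t \<circ> (\<lambda>n. k * n)) \<longlonglongrightarrow> asymptotic_samuel R I x"
    by (rule LIMSEQ_subseq_LIMSEQ[OF asymptotic_samuel_tendsto[OF x]])
  then show "(\<lambda>n. ?t (k * n)) \<longlonglongrightarrow> asymptotic_samuel R I x" by (simp add: o_def)
  have "(\<lambda>n. ennreal_of_enat (filt_order I ((x [^] k) [^] n)) / of_nat n / of_nat k)
      \<longlonglongrightarrow> asymptotic_samuel R I (x [^] k) / of_nat k"
    \<comment> \<open>Division by \<open>k\<close> becomes multiplication by a constant, which is
      finite because \<open>k \<ge> 1\<close>; finiteness is what makes this multiplication
      continuous on \<open>ennreal\<close>.\<close>
    unfolding divide_ennreal_def[of _ "of_nat k"] mult.commute[of _ "inverse (of_nat k)"]
    using x k by (intro ennreal_tendsto_cmult asymptotic_samuel_tendsto)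
      (auto simp: ennreal_of_nat_eq_real_of_nat inverse_ennreal)
  moreover have "u / of_nat n / of_nat k = u / of_nat (k * n)" if "n \<ge> 1" for u :: ennreal and n
    using that k by (simp add: divide_ennreal_def ennreal_inverse_mult ennreal_of_nat_eq_real_of_nat
        mult_ac ennreal_mult)
  ultimately show "(\<lambda>n. ?t (k * n)) \<longlonglongrightarrow> asymptotic_samuel R I (x [^] k) / of_nat k"
    using x by (elim Lim_transform_eventually)
      (auto simp: eventually_sequentially nat_pow_pow intro!: exI[of _ 1])
qed

section \<open>The level sets form a filtration containing \<open>I\<close>\<close>

lemma mem_imp_le_asymptotic_samuel:
  assumes "x \<in> I m"
  shows "of_nat m \<le> asymptotic_samuel R I x"
proof -
  have x: "x \<in> carrier R" using assms ideal.Icarr[OF ideal] by blast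
  \<comment> \<open>Multiplicativity of the filtration gives a linear bound of slope
    \<open>m\<close> with constant 0.\<close>
  have pow: "x [^] n \<in> I (m * n)" for n
  proof (induction n)
    case 0
    then show ?case by (simp add: zero)
  next
    case (Suc n)
    then show ?case using mult[of "m * n" m] ideal_prod.prod[OF Suc assms]
      by (auto simp: add.commute)
  qed
  have "ennreal (real m) \<le> asymptotic_samuel R I x"
  proof (rule le_asymptotic_samuelI[OF x, of _ 0])
    fix n p assume "real p \<le> real m * real n - 0"
    then have "real p \<le> real (m * n)" by simp
    then have "p \<le> m * n" by (simp only: of_nat_le_iff)
    then show "x [^] n \<in> I p" using pow antimono by blast
  qed
  then show ?thesis by (simp add: ennreal_of_nat_eq_real_of_nat)
qed

lemma subset_K_filt: "I m \<subseteq> K_filt R I m"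
  using mem_imp_le_asymptotic_samuel ideal.Icarr[OF ideal] by (auto simp: K_filt_def)

text \<open>Since the function is nonnegative, its superadditivity on products gives closure under
  multiplication by ring elements. Negatives are products with \<open>\<ominus> \<one>\<close>, and
  sums are covered by the bound through the minimum.\<close>

lemma ideal_K_filt: "ideal (K_filt R I m) R"
proof -
  have mult_closed: "r \<otimes> x \<in> K_filt R I m"
    if "r \<in> carrier R" "x \<in> K_filt R I m" for r x
  proof -
    have "of_nat m \<le> asymptotic_samuel R I r + asymptotic_samuel R I x"
      using that by (auto simp: K_filt_def intro: add_increasing)
    also have "\<dots> \<le> asymptotic_samuel R I (r \<otimes> x)"
      using that by (intro asymptotic_samuel_mult) (auto simp: K_filt_def)
    finally show ?thesis using that by (simp add: K_filt_def)
  qed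
  show ?thesis
  proof (rule idealI[OF ring_axioms])
    show "subgroup (K_filt R I m) (add_monoid R)"
    proof (rule add.subgroupI)
      show "K_filt R I m \<noteq> {}"
        using subset_K_filt[of m] additive_subgroup.zero_closed[OF ideal.axioms(1)[OF ideal]]
        by blast
    next
      fix x assume x: "x \<in> K_filt R I m"
      then have "x \<in> carrier R" by (simp add: K_filt_def)
      then show "\<ominus> x \<in> K_filt R I m"
        using mult_closed[of "\<ominus> \<one>" x] x by (simp add: l_minus)
    next
      fix x y assume xy: "x \<in> K_filt R I m" "y \<in> K_filt R I m"
      then have "of_nat m \<le> min (asymptotic_samuel R I x) (asymptotic_samuel R I y)"
        by (simp add: K_filt_def)
      also have "\<dots> \<le> asymptotic_samuel R I (x \<oplus> y)"
        using xy by (intro asymptotic_samuel_add) (auto simp: K_filt_def)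
      finally show "x \<oplus> y \<in> K_filt R I m" using xy by (simp add: K_filt_def)
    qed (auto simp: K_filt_def)
  next
    fix x r assume xr: "x \<in> K_filt R I m" "r \<in> carrier R"
    then show "r \<otimes> x \<in> K_filt R I m" by (intro mult_closed)
    then show "x \<otimes> r \<in> K_filt R I m" using xr m_comm[of x r] by (simp add: K_filt_def)
  qed
qed

lemma ring_filtration_K_filt: "ring_filtration R (K_filt R I)"
proof (intro ring_filtration.intro ring_filtration_axioms.intro)
  show "cring R" by (rule is_cring)
  show "K_filt R I 0 = carrier R" by (auto simp: K_filt_def)
  show "ideal (K_filt R I m) R" for m by (rule ideal_K_filt)
  show "K_filt R I (Suc n) \<subseteq> K_filt R I n" for n
    by (auto simp: K_filt_def intro: order_trans[rotated])
  show "K_filt R I n \<cdot> K_filt R I m \<subseteq> K_filt R I (n + m)" for n m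
  proof
    fix z assume "z \<in> K_filt R I n \<cdot> K_filt R I m"
    then show "z \<in> K_filt R I (n + m)"
    \<comment> \<open>The ideal product is generated from products by sums: superadditivity settles
      the products, and the ideal property of the level set settles the sums.\<close>
    proof induction
      case (prod x y)
      then have "of_nat (n + m) \<le> asymptotic_samuel R I x + asymptotic_samuel R I y"
        by (auto simp: K_filt_def intro: add_mono)
      also have "\<dots> \<le> asymptotic_samuel R I (x \<otimes> y)"
        using prod by (intro asymptotic_samuel_mult) (auto simp: K_filt_def)
      finally show ?case using prod by (simp add: K_filt_def)
    next
      case (sum s1 s2)
      then show ?case
        using additive_subgroup.a_closed[OF ideal.axioms(1)[OF ideal_K_filt]] by blast
    qed
  qed
qed

section \<open>Equality of the two asymptotic functions and maximality\<close>

lemma filt_order_K_filt_le: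
  "ennreal_of_enat (filt_order (K_filt R I) x) \<le> asymptotic_samuel R I x"
  unfolding filt_order_def ennreal_of_enat_Sup by (rule SUP_least) (auto simp: K_filt_def)

lemma asymptotic_samuel_K_filt:
  assumes x: "x \<in> carrier R"
  shows "asymptotic_samuel R (K_filt R I) x = asymptotic_samuel R I x"
proof (rule antisym)
  interpret K: ring_filtration R "K_filt R I" by (rule ring_filtration_K_filt)
  show "asymptotic_samuel R (K_filt R I) x \<le> asymptotic_samuel R I x"
  \<comment> \<open>Every single quotient with \<open>n \<ge> 1\<close> is already bounded by the
    value for \<open>I\<close>, by homogeneity, so the limit is too.\<close>
  proof (rule LIMSEQ_le_const2[OF K.asymptotic_samuel_tendsto[OF x]], intro exI[of _ 1] allI impI)
    fix n :: nat assume n: "1 \<le> n"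
    have "ennreal_of_enat (filt_order (K_filt R I) (x [^] n)) / of_nat n
        \<le> asymptotic_samuel R I (x [^] n) / of_nat n"
      by (intro divide_right_mono_ennreal filt_order_K_filt_le)
    then show "ennreal_of_enat (filt_order (K_filt R I) (x [^] n)) / of_nat n
        \<le> asymptotic_samuel R I x"
      by (simp add: asymptotic_samuel_pow[OF x n])
  qed
  \<comment> \<open>The converse inequality is monotonicity: enlarging the filtration can only raise
    the order.\<close>
  have "filt_order I f \<le> filt_order (K_filt R I) f" for f
    unfolding filt_order_def using subset_K_filt by (intro Sup_subset_mono) auto
  then show "asymptotic_samuel R I x \<le> asymptotic_samuel R (K_filt R I) x"
    by (intro LIMSEQ_le[OF asymptotic_samuel_tendsto[OF x] K.asymptotic_samuel_tendsto[OF x]]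
        exI[of _ 0] allI impI divide_right_mono_ennreal) simp
qed

end

theorem theorem1p3:
  fixes R :: "('a, 'b) ring_scheme" and I :: "nat \<Rightarrow> 'a set"
  assumes "noetherian_ring R" and "ring_filtration R I"
  shows "ring_filtration R (K_filt R I) \<and>
    (\<forall>m. I m \<subseteq> K_filt R I m) \<and>
    (\<forall>x\<in>carrier R. asymptotic_samuel R I x = asymptotic_samuel R (K_filt R I) x) \<and>
    (\<forall>J. ring_filtration R J \<and>
         (\<forall>x\<in>carrier R. asymptotic_samuel R I x = asymptotic_samuel R J x)
       \<longrightarrow> (\<forall>m. J m \<subseteq> K_filt R I m)) \<and>
    (\<forall>L. ring_filtration R L \<and>
         (\<forall>x\<in>carrier R. asymptotic_samuel R I x = asymptotic_samuel R L x) \<and>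
         (\<forall>J. ring_filtration R J \<and>
              (\<forall>x\<in>carrier R. asymptotic_samuel R I x = asymptotic_samuel R J x)
            \<longrightarrow> (\<forall>m. J m \<subseteq> L m))
       \<longrightarrow> L = K_filt R I)"
proof -
  interpret ring_filtration R I by fact
  \<comment> \<open>An element of \<open>J m\<close> has asymptotic value at least \<open>m\<close>
    for \<open>J\<close>, hence also for \<open>I\<close>, which is the condition defining the level
    set.\<close>
  have sub: "J m \<subseteq> K_filt R I m"
    if "ring_filtration R J"
      and eq: "\<forall>x\<in>carrier R. asymptotic_samuel R I x = asymptotic_samuel R J x" for J m
  proof -
    interpret J: ring_filtration R J by fact
    show ?thesis using J.subset_K_filt[of m] eq by (auto simp: K_filt_def)
  qed
  \<comment> \<open>A largest filtration \<open>L\<close> lies in \<open>K_filt R I\<close> by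
    \<open>sub\<close>, and contains it because \<open>K_filt R I\<close> is itself one of the
    competitors \<open>J\<close>.\<close>
  have largest: "L = K_filt R I"
    if "ring_filtration R L"
      "\<forall>x\<in>carrier R. asymptotic_samuel R I x = asymptotic_samuel R L x"
      "\<forall>J. ring_filtration R J \<and>
         (\<forall>x\<in>carrier R. asymptotic_samuel R I x = asymptotic_samuel R J x)
         \<longrightarrow> (\<forall>m. J m \<subseteq> L m)" for L
  proof (intro ext subset_antisym)
    fix m
    show "L m \<subseteq> K_filt R I m" using that(1,2) by (rule sub)
    show "K_filt R I m \<subseteq> L m"
      using that(3) ring_filtration_K_filt asymptotic_samuel_K_filt by simp
  qed
  show ?thesis
  proof (intro conjI)
    show "ring_filtration R (K_filt R I)" by (rule ring_filtration_K_filt)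
    show "\<forall>m. I m \<subseteq> K_filt R I m" using subset_K_filt by blast
    show "\<forall>x\<in>carrier R. asymptotic_samuel R I x = asymptotic_samuel R (K_filt R I) x"
      using asymptotic_samuel_K_filt by simp
  qed (use sub largest in blast)+
qed

end
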